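(* There exist positive real constants $c_1$ and $c_2$ such that \[ 2^{c_1n^2}\leq f_{\mathrm{kei}}(n)\leq f_{\mathrm{quandle}}(n)\leq f_{\mathrm{rack}}(n)\leq 2^{c_2n^2} \] for all sufficiently large integers $n$.
   Context: A rack is a set $X$ together with a binary operation $\vartriangleright:X\times X\to X$ such that (i) for all $y\in X$ the map $f_y:X\to X$, $x\mapsto x\vartriangleright y$, is a bijection; and (ii) for all $x,y,z\in X$, $(x\vartriangleright y)\vartriangleright z=(x\vartriangleright z)\vartriangleright(y\vartriangleright z)$. A quandle is a rack such that $x\vartriangleright x=x$ for all $x\in X$. A kei is a quandle such that for every $y\in X$ the permutation $f_y$ has order dividing $2$ (i.e. $f_y\circ f_y$ is the identity). An isomorphism from a rack $(X,\vartriangleright)$ to a rack $(X',\vartriangleright')$ is a bijection $\theta:X\to X'$ such that $\theta(x)\vartriangleright'\theta(y)=\theta(x\vartriangleright y)$ for all $x,y\in X$. A rack, quandle or kei has order $n$ if its underlying set is finite of cardinality $n$. $f_{\mathrm{rack}}(n)$, $f_{\mathrm{quandle}}(n)$ and $f_{\mathrm{kei}}(n)$ denote the number of isomorphism classes of racks, quandles and kei of order $n$, respectively. *)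

theory Defs
  imports Complex_Main
begin

locale rack =
  fixes X :: "'a set" and rop :: "'a \<Rightarrow> 'a \<Rightarrow> 'a" (infixl \<open>\<triangleright>\<close> 70)
  assumes bij: "y \<in> X \<Longrightarrow> bij_betw (\<lambda>x. x \<triangleright> y) X X"
    and distrib: "\<lbrakk>x \<in> X; y \<in> X; z \<in> X\<rbrakk> \<Longrightarrow> (x \<triangleright> y) \<triangleright> z = (x \<triangleright> z) \<triangleright> (y \<triangleright> z)"

locale quandle = rack +
  assumes idem: "x \<in> X \<Longrightarrow> x \<triangleright> x = x"

locale kei = quandle +
  assumes invol: "\<lbrakk>x \<in> X; y \<in> X\<rbrakk> \<Longrightarrow> (x \<triangleright> y) \<triangleright> y = x"

definition rack_iso ::
    "('a \<Rightarrow> 'b) \<Rightarrow> 'a set \<Rightarrow> ('a \<Rightarrow> 'a \<Rightarrow> 'a) \<Rightarrow> 'b set \<Rightarrow> ('b \<Rightarrow> 'b \<Rightarrow> 'b) \<Rightarrow> bool" where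
  "rack_iso \<theta> X f X' f' \<longleftrightarrow>
     bij_betw \<theta> X X' \<and> (\<forall>x\<in>X. \<forall>y\<in>X. f' (\<theta> x) (\<theta> y) = \<theta> (f x y))"

text \<open>Every finite structure is isomorphic to one whose underlying set is a set of natural
  numbers, so isomorphism classes are counted among those. An operation may take arbitrary values
  outside its underlying set; two operations that agree on the underlying set are isomorphic via
  the identity, so this does not affect the number of classes.\<close>

type_synonym magma = "nat set \<times> (nat \<Rightarrow> nat \<Rightarrow> nat)"

definition isomorphic :: "(magma \<times> magma) set" where
  "isomorphic = {((X, f), (X', f')). \<exists>\<theta>. rack_iso \<theta> X f X' f'}"

definition of_order :: "(nat set \<Rightarrow> (nat \<Rightarrow> nat \<Rightarrow> nat) \<Rightarrow> bool) \<Rightarrow> nat \<Rightarrow> magma set" where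
  "of_order P n = {(X, f). P X f \<and> finite X \<and> card X = n}"

definition iso_classes :: "magma set \<Rightarrow> magma set set" where
  "iso_classes S = S // Restr isomorphic S"

definition f_rack :: "nat \<Rightarrow> nat" where
  "f_rack n = card (iso_classes (of_order rack n))"

definition f_quandle :: "nat \<Rightarrow> nat" where
  "f_quandle n = card (iso_classes (of_order quandle n))"

definition f_kei :: "nat \<Rightarrow> nat" where
  "f_kei n = card (iso_classes (of_order kei n))"

lemma equiv_isomorphic:
  assumes "S \<subseteq> of_order rack n"
  shows "equiv S (Restr isomorphic S)"
proof (rule equivI)
  show "Restr isomorphic S \<subseteq> S \<times> S"
    by blast
  have "rack_iso id X f X f" for X :: "nat set" and f
    by (simp add: rack_iso_def)
  then show "refl_on S (Restr isomorphic S)"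
    unfolding refl_on_def isomorphic_def by blast
  have "rack_iso (inv_into X \<theta>) X' f' X f"
    if r: "rack X f" and i: "rack_iso \<theta> X f X' f'" for X X' :: "nat set" and f f' \<theta>
    unfolding rack_iso_def
  proof (intro conjI ballI)
    have b: "bij_betw \<theta> X X'" and h: "\<And>x y. x \<in> X \<Longrightarrow> y \<in> X \<Longrightarrow> f' (\<theta> x) (\<theta> y) = \<theta> (f x y)"
      using i by (auto simp: rack_iso_def)
    show "bij_betw (inv_into X \<theta>) X' X"
      using b by (rule bij_betw_inv_into)
    fix u v assume "u \<in> X'" "v \<in> X'"
    then obtain x y where xy: "x \<in> X" "y \<in> X" "u = \<theta> x" "v = \<theta> y"
      using b by (auto simp: bij_betw_def)
    moreover have "f x y \<in> X"
      using rack.bij[OF r xy(2)] xy(1) by (auto simp: bij_betw_def)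
    ultimately show "f (inv_into X \<theta> u) (inv_into X \<theta> v) = inv_into X \<theta> (f' u v)"
      using b h by (simp add: bij_betw_inv_into_left)
  qed
  then show "sym (Restr isomorphic S)"
    using assms unfolding sym_def isomorphic_def of_order_def by blast
  have "rack_iso (\<eta> \<circ> \<theta>) X f X'' f''"
    if "rack_iso \<theta> X f X' f'" "rack_iso \<eta> X' f' X'' f''"
    for X X' X'' :: "nat set" and f f' f'' \<theta> \<eta>
    using that unfolding rack_iso_def by (auto intro: bij_betw_trans simp: bij_betw_apply)
  then show "trans (Restr isomorphic S)"
    unfolding trans_def isomorphic_def by blast
qed

end

theory Submission
  imports Defs "HOL-Library.FuncSet" "HOL-Real_Asymp.Real_Asymp"
begin

text \<open>
  Lower bound: on \<open>m\<close> disjoint pairs \<open>{2i, 2i + 1}\<close> and \<open>n - 2m\<close> further points, let every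
  further point act by swapping an arbitrary subset of the pairs, and let the points of the pairs
  act trivially. With \<open>m\<close> about \<open>n/4\<close> this gives about \<open>2 powr (n\<^sup>2/8)\<close> kei on \<open>{..<n}\<close>, and an
  isomorphism class contains at most \<open>n ^ n\<close> of them.

  Upper bound: write \<open>f\<^sub>y\<close> for the permutation \<open>x \<mapsto> x \<triangleright> y\<close> and \<open>L = log 2 n\<close>. For a set \<open>W\<close> of colours, consider
  the orbits of the group generated by the \<open>f\<^sub>w\<close>, \<open>w \<in> W\<close>, and the potential
  \<open>\<Sum>x. log 2 (size of the orbit of x)\<close>, which is at most \<open>n L\<close>. If \<open>f\<^sub>y\<close> moves many points out of
  their orbits, then adding \<open>y\<close> to \<open>W\<close> increases the potential a lot, so a polylogarithmic \<open>W\<close>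
  exists for which every \<open>f\<^sub>y\<close> moves few points out of their orbits. Self-distributivity has two
  consequences: knowing \<open>f\<^sub>w\<close> for \<open>w \<in> W\<close> determines \<open>f\<^sub>v\<close> for all \<open>v\<close> in the orbit of some
  \<open>w \<in> W\<close>; and if \<open>f\<^sub>w\<close> and \<open>f\<^bsub>w \<triangleright> y\<^esub>\<close> are known for all \<open>w \<in> V\<close>, then \<open>f\<^sub>y\<close> is determined by its
  values at one representative of each \<open>V\<close>-orbit. As almost all these values stay inside their
  orbit, \<open>f\<^sub>y\<close> costs only \<open>O(n)\<close> bits. For the \<open>O(n / L)\<close> exceptional \<open>y\<close>, all of \<open>f\<^sub>y\<close> is stored
  with \<open>O(n L)\<close> bits.
\<close>

section \<open>Orbits generated by a set of colours\<close>

definition orbit_rel :: "'a set \<Rightarrow> ('a \<Rightarrow> 'a \<Rightarrow> 'a) \<Rightarrow> 'a set \<Rightarrow> ('a \<times> 'a) set" where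
  "orbit_rel X f W = (let E = {(x, f x w) |x w. x \<in> X \<and> w \<in> W} in (E \<union> E\<inverse>)\<^sup>*)"

definition moved :: "'a set \<Rightarrow> ('a \<Rightarrow> 'a \<Rightarrow> 'a) \<Rightarrow> 'a set \<Rightarrow> 'a \<Rightarrow> 'a set" where
  "moved X f W y = {x \<in> X. (x, f x y) \<notin> orbit_rel X f W}"

definition potential :: "'a set \<Rightarrow> ('a \<Rightarrow> 'a \<Rightarrow> 'a) \<Rightarrow> 'a set \<Rightarrow> real" where
  "potential X f W = (\<Sum>x\<in>X. log 2 (card (orbit_rel X f W `` {x})))"

lemma orbit_rel_refl [simp]: "(x, x) \<in> orbit_rel X f W"
  by (simp add: orbit_rel_def Let_def)

lemma orbit_rel_sym: "(x, y) \<in> orbit_rel X f W \<Longrightarrow> (y, x) \<in> orbit_rel X f W"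
  unfolding orbit_rel_def Let_def by (meson sym_Un_converse sym_rtrancl symD)

lemma orbit_rel_trans:
  "(x, y) \<in> orbit_rel X f W \<Longrightarrow> (y, z) \<in> orbit_rel X f W \<Longrightarrow> (x, z) \<in> orbit_rel X f W"
  unfolding orbit_rel_def Let_def by (rule rtrancl_trans)

lemma orbit_rel_step: "x \<in> X \<Longrightarrow> w \<in> W \<Longrightarrow> (x, f x w) \<in> orbit_rel X f W"
  unfolding orbit_rel_def Let_def by (rule r_into_rtrancl) blast

lemma orbit_rel_mono: "W \<subseteq> V \<Longrightarrow> orbit_rel X f W \<subseteq> orbit_rel X f V"
  unfolding orbit_rel_def Let_def by (rule rtrancl_mono) blast

text \<open>Replaces induction on words in the permutations and their inverses: a property spreads
  over an orbit once it passes along every edge both ways.\<close>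

lemma orbit_rel_induct [consumes 3, case_names base forward backward]:
  assumes r: "(u, v) \<in> orbit_rel X f W" and "u \<in> X"
    and closed: "\<And>x w. x \<in> X \<Longrightarrow> w \<in> W \<Longrightarrow> f x w \<in> X"
    and start: "P u"
    and fw: "\<And>x w. x \<in> X \<Longrightarrow> w \<in> W \<Longrightarrow> P x \<Longrightarrow> P (f x w)"
    and bw: "\<And>x w. x \<in> X \<Longrightarrow> w \<in> W \<Longrightarrow> P (f x w) \<Longrightarrow> P x"
  shows "v \<in> X \<and> P v"
  using r unfolding orbit_rel_def Let_def
proof (induction rule: rtrancl_induct)
  case base
  then show ?case using \<open>u \<in> X\<close> start by blast
next
  case (step y z)
  then consider w where "y \<in> X" "w \<in> W" "z = f y w" | w where "z \<in> X" "w \<in> W" "y = f z w"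
    by blast
  then show ?case
  proof cases
    case 1
    then show ?thesis using step.IH closed fw by blast
  next
    case 2
    then show ?thesis using step.IH bw[of z w] by blast
  qed
qed

lemma orbit_rel_cong:
  assumes "\<And>x w. x \<in> X \<Longrightarrow> w \<in> W \<Longrightarrow> f x w = g x w"
  shows "orbit_rel X f W = orbit_rel X g W"
proof -
  have "{(x, f x w) |x w. x \<in> X \<and> w \<in> W} = {(x, g x w) |x w. x \<in> X \<and> w \<in> W}"
    using assms by force
  then show ?thesis
    by (simp add: orbit_rel_def)
qed

context rack
begin

lemma closed: "x \<in> X \<Longrightarrow> y \<in> X \<Longrightarrow> x \<triangleright> y \<in> X"
  using bij[of y] by (auto simp: bij_betw_def)

lemma cancel: "\<lbrakk>x \<triangleright> y = z \<triangleright> y; x \<in> X; z \<in> X; y \<in> X\<rbrakk> \<Longrightarrow> x = z"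
  using bij[of y] by (auto simp: bij_betw_def dest: inj_onD)

lemma orbit_subset:
  assumes "W \<subseteq> X" "x \<in> X"
  shows "orbit_rel X (\<triangleright>) W `` {x} \<subseteq> X"
proof
  fix v assume "v \<in> orbit_rel X (\<triangleright>) W `` {x}"
  then have r: "(x, v) \<in> orbit_rel X (\<triangleright>) W" by simp
  have c: "y \<triangleright> w \<in> X" if "y \<in> X" "w \<in> W" for y w
    using closed that assms by blast
  show "v \<in> X"
    using orbit_rel_induct[OF r assms(2) c, of "\<lambda>_. True"] by simp
qed

end

section \<open>Orbit sizes, the potential and the choice of colour sets\<close>

locale finite_rack = rack +
  assumes finite_carrier [simp, intro]: "finite X"
begin

abbreviation orb where "orb W x \<equiv> orbit_rel X (\<triangleright>) W `` {x}"

lemma finite_orb: "W \<subseteq> X \<Longrightarrow> x \<in> X \<Longrightarrow> finite (orb W x)"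
  using orbit_subset[of W x] finite_carrier by (rule finite_subset)

lemma card_orb_pos: "W \<subseteq> X \<Longrightarrow> x \<in> X \<Longrightarrow> card (orb W x) > 0"
  using finite_orb[of W x] orbit_rel_refl[of x X "(\<triangleright>)" W] card_gt_0_iff by blast

lemma potential_le:
  assumes "W \<subseteq> X"
  shows "potential X (\<triangleright>) W \<le> card X * log 2 (card X)"
proof -
  have "log 2 (card (orb W x)) \<le> log 2 (card X)" if "x \<in> X" for x
    using card_mono[OF finite_carrier orbit_subset[OF assms that]] card_orb_pos[OF assms that]
    by simp
  then show ?thesis
    unfolding potential_def using sum_bounded_above[of X _ "log 2 (card X)"] by simp
qed

text \<open>If \<open>y\<close> joins the distinct orbits of \<open>x\<close> and \<open>x \<triangleright> y\<close>, then the orbit of at least one of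
  these two points at least doubles.\<close>

lemma card_moved_le:
  assumes W: "W \<subseteq> X" and y: "y \<in> X"
  shows "card (moved X (\<triangleright>) W y) \<le> 2 * (potential X (\<triangleright>) (insert y W) - potential X (\<triangleright>) W)"
proof -
  let ?W = "insert y W"
  define D where "D = {x \<in> X. 2 * card (orb W x) \<le> card (orb ?W x)}"
  have W': "?W \<subseteq> X" using W y by simp
  have mono: "orb W x \<subseteq> orb ?W x" for x
    using orbit_rel_mono[of W ?W] by blast
  have "moved X (\<triangleright>) W y \<subseteq> D \<union> {x \<in> X. x \<triangleright> y \<in> D}"
  proof
    fix x assume "x \<in> moved X (\<triangleright>) W y"
    then have x: "x \<in> X" and n: "(x, x \<triangleright> y) \<notin> orbit_rel X (\<triangleright>) W"
      by (auto simp: moved_def)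
    let ?z = "x \<triangleright> y"
    have z: "?z \<in> X" using x y closed by simp
    have "orb W x \<inter> orb W ?z = {}"
      using n orbit_rel_sym orbit_rel_trans by fast
    then have "card (orb W x) + card (orb W ?z) = card (orb W x \<union> orb W ?z)"
      using finite_orb W x z by (simp add: card_Un_disjoint)
    also have xz: "orb ?W ?z = orb ?W x"
      using orbit_rel_step[of x X y ?W "(\<triangleright>)"] x orbit_rel_sym orbit_rel_trans by fast
    then have "card (orb W x \<union> orb W ?z) \<le> card (orb ?W x)"
      using mono[of x] mono[of ?z] finite_orb[OF W' x] by (intro card_mono) auto
    finally show "x \<in> D \<union> {x \<in> X. x \<triangleright> y \<in> D}"
      using x z xz by (auto simp: D_def)
  qed
  moreover have fD: "finite D" by (simp add: D_def)
  ultimately have "card (moved X (\<triangleright>) W y) \<le> card (D \<union> {x \<in> X. x \<triangleright> y \<in> D})"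
    by (intro card_mono) auto
  also have "\<dots> \<le> card D + card {x \<in> X. x \<triangleright> y \<in> D}"
    by (rule card_Un_le)
  also have "card {x \<in> X. x \<triangleright> y \<in> D} \<le> card D"
    by (rule card_inj_on_le[of "\<lambda>x. x \<triangleright> y"]) (auto simp: inj_on_def fD intro: cancel y)
  finally have 1: "card (moved X (\<triangleright>) W y) \<le> 2 * card D"
    by simp
  have "real (card D) = (\<Sum>x\<in>X. if x \<in> D then 1 else 0)"
    by (simp add: D_def sum.If_cases Int_def conj_commute)
  also have "\<dots> \<le> (\<Sum>x\<in>X. log 2 (card (orb ?W x)) - log 2 (card (orb W x)))"
  proof (rule sum_mono)
    fix x assume x: "x \<in> X"
    have p: "card (orb W x) > 0" using card_orb_pos W x by simp
    have q: "card (orb W x) \<le> card (orb ?W x)"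
      using mono finite_orb[OF W' x] by (simp add: card_mono)
    show "(if x \<in> D then 1 else 0) \<le> log 2 (card (orb ?W x)) - log 2 (card (orb W x))"
    proof (cases "x \<in> D")
      case True
      have "1 + log 2 (card (orb W x)) = log 2 (2 * card (orb W x))"
        using p by (simp add: log_mult)
      also have "\<dots> \<le> log 2 (card (orb ?W x))"
        using True p q by (subst log_le_cancel_iff) (auto simp: D_def)
      finally show ?thesis using True by simp
    next
      case False
      then show ?thesis using p q by simp
    qed
  qed
  finally show ?thesis
    using 1 by (simp add: potential_def sum_subtractf)
qed

text \<open>Take a largest \<open>W\<close> whose potential is at least \<open>\<delta>\<close> per
  colour: a colour of \<open>S\<close> raising the potential by more than \<open>\<delta>\<close>
  could still be added. The bound on the potential limits \<open>card W\<close>, and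
  \<open>card_moved_le\<close> supplies the factor 2.\<close>

lemma exists_few_moved:
  fixes \<delta> :: real
  assumes "\<delta> > 0" "S \<subseteq> X"
  obtains W where "W \<subseteq> S" "card W * \<delta> \<le> card X * log 2 (card X)"
    "\<And>y. y \<in> S \<Longrightarrow> card (moved X (\<triangleright>) W y) \<le> 2 * \<delta>"
proof -
  let ?F = "{W. W \<subseteq> S \<and> card W * \<delta> \<le> potential X (\<triangleright>) W}"
  have finS: "finite S" using assms(2) finite_subset by blast
  have "0 \<le> potential X (\<triangleright>) {}"
    unfolding potential_def
  proof (rule sum_nonneg)
    fix x assume "x \<in> X"
    then show "0 \<le> log 2 (card (orb {} x))"
      using card_orb_pos[of "{}" x] by simp
  qed
  then have "{} \<in> ?F" by simp
  moreover have "\<forall>W. W \<in> ?F \<longrightarrow> card W < card S + 1"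
    using finS by (auto simp: less_Suc_eq_le intro: card_mono)
  ultimately obtain W where W: "W \<in> ?F" and mx: "\<forall>V. V \<in> ?F \<longrightarrow> card V \<le> card W"
    using ex_has_greatest_nat[of "\<lambda>W. W \<in> ?F" "{}" card "card S + 1"] by blast
  show thesis
  proof
    show "W \<subseteq> S" using W by simp
    have WX: "W \<subseteq> X" using W assms by auto
    show "card W * \<delta> \<le> card X * log 2 (card X)"
      using W potential_le[OF WX] by simp
    fix y assume y: "y \<in> S"
    then have yX: "y \<in> X" using assms by auto
    have "potential X (\<triangleright>) (insert y W) - potential X (\<triangleright>) W \<le> \<delta>"
    proof (rule ccontr)
      assume c: "\<not> ?thesis"
      then have "y \<notin> W" using assms(1) by (auto simp: insert_absorb)
      then have cc: "card (insert y W) = card W + 1"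
        using W finS finite_subset[of W S] by auto
      then have "insert y W \<in> ?F"
        using W y c by (auto simp: algebra_simps)
      then have "card (insert y W) \<le> card W" using mx by blast
      then show False using cc by simp
    qed
    then show "card (moved X (\<triangleright>) W y) \<le> 2 * \<delta>"
      using card_moved_le[OF WX yX] by (smt (verit, best))
  qed
qed

text \<open>The set \<open>V\<close> is chosen among points that few colours move off their \<open>W\<^sub>0\<close>-orbit, so that
  for all but few colours \<open>y\<close> every \<open>w \<triangleright> y\<close> with \<open>w \<in> V\<close> stays in the \<open>W\<close>-orbit of \<open>w\<close>.\<close>

lemma exists_skeleton:
  fixes L :: real
  assumes "L > 0" and L: "log 2 (card X) \<le> L"
  obtains V W K where "V \<subseteq> W" "W \<subseteq> K" "K \<subseteq> X" "card V \<le> L ^ 2"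
    "card K \<le> L ^ 5 + L ^ 2 + 4 * card X / L"
    "\<And>y. y \<in> X - K \<Longrightarrow> card (moved X (\<triangleright>) V y) \<le> 2 * card X / L"
    "\<And>y w. y \<in> X - K \<Longrightarrow> w \<in> V \<Longrightarrow> (w, w \<triangleright> y) \<in> orbit_rel X (\<triangleright>) W"
proof (cases "X = {}")
  case True
  then show thesis using that[of "{}" "{}" "{}"] assms by simp
next
  case False
  define n where "n = real (card X)"
  have n: "n > 0" using False by (simp add: n_def card_gt_0_iff)
  obtain W0 where W0: "W0 \<subseteq> X" "card W0 * (n / L ^ 4) \<le> n * log 2 n"
    "\<And>y. y \<in> X \<Longrightarrow> card (moved X (\<triangleright>) W0 y) \<le> 2 * (n / L ^ 4)"
    using exists_few_moved[of "n / L ^ 4" X, folded n_def] n \<open>L > 0\<close>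
    by (metis divide_pos_pos order_refl zero_less_power)
  define movers where "movers w = {y \<in> X. w \<in> moved X (\<triangleright>) W0 y}" for w
  \<comment> \<open>The threshold \<open>n / L ^ 3\<close> serves two counts: by the bound on moves
    for \<open>W0\<close>, at most \<open>2 * n / L\<close> points exceed it, and the at most
    \<open>L ^ 2\<close> points of \<open>V\<close> are moved by at most \<open>n / L\<close>
    colours altogether.\<close>
  define good where "good = {w \<in> X. card (movers w) \<le> n / L ^ 3}"
  have good: "good \<subseteq> X" by (auto simp: good_def)
  obtain V where V: "V \<subseteq> good" "card V * (n / L) \<le> n * log 2 n"
    "\<And>y. y \<in> good \<Longrightarrow> card (moved X (\<triangleright>) V y) \<le> 2 * (n / L)"
    using exists_few_moved[of "n / L" good, folded n_def] n \<open>L > 0\<close> good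
    by (metis divide_pos_pos)
  have finV: "finite V" using V good finite_subset[of V X] by auto
  define W where "W = W0 \<union> V"
  \<comment> \<open>The exceptional colours are those in \<open>W\<close>, those outside
    \<open>good\<close>, for which the choice of \<open>V\<close> promises nothing, and those moving
    a point of \<open>V\<close> off its \<open>W0\<close>-orbit.\<close>
  define K where "K = W \<union> (X - good) \<union> (\<Union>w\<in>V. movers w)"
  have "n * log 2 n \<le> n * L" using n L by (simp add: n_def)
  then have "card W0 * (n / L ^ 4) \<le> n * L" "card V * (n / L) \<le> n * L"
    using W0(2) V(2) by linarith+
  then have cW0: "card W0 \<le> L ^ 5" and cV: "card V \<le> L ^ 2"
    using n assms(1) by (simp_all add: field_simps power_numeral_reduce)
  have "card (X - good) * (n / L ^ 3) \<le> (\<Sum>w\<in>X - good. real (card (movers w)))"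
    by (rule sum_bounded_below[where A = "X - good", simplified mult.commute]) (auto simp: good_def)
  also have "\<dots> \<le> (\<Sum>w\<in>X. real (card (movers w)))"
    by (rule sum_mono2) auto
  also have "\<dots> = (\<Sum>w\<in>X. \<Sum>y\<in>X. if w \<in> moved X (\<triangleright>) W0 y then 1 else 0)"
    by (simp add: movers_def sum.If_cases Int_def)
  also have "\<dots> = (\<Sum>y\<in>X. \<Sum>w\<in>X. if w \<in> moved X (\<triangleright>) W0 y then 1 else 0)"
    by (rule sum.swap)
  also have "\<dots> = (\<Sum>y\<in>X. real (card (moved X (\<triangleright>) W0 y)))"
    by (simp add: moved_def sum.If_cases Int_def cong: conj_cong)
  also have "\<dots> \<le> n * (2 * (n / L ^ 4))"
    using sum_bounded_above[of X "\<lambda>y. real (card (moved X (\<triangleright>) W0 y))" "2 * (n / L ^ 4)"] W0(3)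
    by (simp add: n_def)
  finally have cG: "card (X - good) \<le> 2 * n / L"
    using n assms(1) by (simp add: field_simps power_numeral_reduce)
  have "real (card (\<Union>w\<in>V. movers w)) \<le> (\<Sum>w\<in>V. real (card (movers w)))"
    using card_UN_le[OF finV, of movers] by (metis of_nat_le_iff of_nat_sum)
  also have "\<dots> \<le> card V * (n / L ^ 3)"
    using sum_bounded_above[of V "\<lambda>w. real (card (movers w))" "n / L ^ 3"] V(1)
    by (auto simp: good_def)
  also have "\<dots> \<le> L ^ 2 * (n / L ^ 3)"
    using cV n assms(1) by (intro mult_right_mono) auto
  also have "\<dots> = n / L"
    using assms(1) by (simp add: field_simps power_numeral_reduce)
  finally have cM: "card (\<Union>w\<in>V. movers w) \<le> n / L" .
  show thesis
  proof
    show "V \<subseteq> W" "W \<subseteq> K" by (auto simp: W_def K_def)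
    show "K \<subseteq> X" using W0 V good by (auto simp: W_def K_def movers_def)
    show "card V \<le> L ^ 2" by (rule cV)
    have "card K \<le> card W + card (X - good) + card (\<Union>w\<in>V. movers w)"
      unfolding K_def by (meson card_Un_le add_mono order_refl order_trans)
    also have "card W \<le> card W0 + card V"
      unfolding W_def by (rule card_Un_le)
    finally have "real (card K) \<le> card W0 + card V + card (X - good) + card (\<Union>w\<in>V. movers w)"
      by linarith
    also have "\<dots> \<le> L ^ 5 + L ^ 2 + 2 * n / L + n / L"
      using cW0 cV cG cM by linarith
    also have "\<dots> \<le> L ^ 5 + L ^ 2 + 4 * n / L"
      using n assms(1) by (simp add: field_simps)
    finally show "card K \<le> L ^ 5 + L ^ 2 + 4 * card X / L"
      by (simp add: n_def)
    fix y assume y: "y \<in> X - K"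
    then show "card (moved X (\<triangleright>) V y) \<le> 2 * card X / L"
      using V(3)[of y] by (auto simp: K_def n_def)
    fix w assume w: "w \<in> V"
    then have "w \<notin> moved X (\<triangleright>) W0 y"
      using y by (auto simp: K_def movers_def)
    then have "(w, w \<triangleright> y) \<in> orbit_rel X (\<triangleright>) W0"
      using w V(1) good by (auto simp: moved_def)
    then show "(w, w \<triangleright> y) \<in> orbit_rel X (\<triangleright>) W"
      using orbit_rel_mono[of W0 W X "(\<triangleright>)"] by (auto simp: W_def)
  qed
qed

end

section \<open>Short codes for racks\<close>

text \<open>The choice depends only on the relation, so two racks with the same
  \<open>V\<close>-orbits share their representatives, as decoding requires.\<close>

definition orbit_rep :: "('a \<times> 'a) set \<Rightarrow> 'a \<Rightarrow> 'a" where
  "orbit_rep R x = (SOME z. (x, z) \<in> R)"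

lemma orbit_rep_related: "(x, orbit_rep (orbit_rel X f V) x) \<in> orbit_rel X f V"
  unfolding orbit_rep_def by (rule someI[of _ x]) simp

lemma orbit_rep_eq:
  assumes "(x, y) \<in> orbit_rel X f V"
  shows "orbit_rep (orbit_rel X f V) x = orbit_rep (orbit_rel X f V) y"
proof -
  have "(\<lambda>z. (x, z) \<in> orbit_rel X f V) = (\<lambda>z. (y, z) \<in> orbit_rel X f V)"
    using assms orbit_rel_sym orbit_rel_trans by fast
  then show ?thesis by (simp add: orbit_rep_def)
qed

text \<open>A triple \<open>(y, x, z) \<in> P\<close> records an explicitly stored value \<open>f x y = z\<close>. If \<open>f\<close> moves a
  representative \<open>r\<close> inside its own \<open>V\<close>-orbit, then \<open>f r y\<close> is the only element of that orbit in
  \<open>{z. (y, z) \<in> A}\<close>, so that one bit per pair \<open>(y, z)\<close> is enough.\<close>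

definition encodes ::
    "'a set \<Rightarrow> ('a \<Rightarrow> 'a \<Rightarrow> 'a) \<Rightarrow> 'a set \<times> 'a set \<times> ('a \<times> 'a \<times> 'a) set \<times> ('a \<times> 'a) set \<Rightarrow> bool" where
  "encodes X f = (\<lambda>(V, W, P, A).
     V \<subseteq> W \<and> W \<subseteq> X \<and>
     (\<forall>y x z. (y, x, z) \<in> P \<longrightarrow> f x y = z) \<and>
     (\<forall>y\<in>W. \<forall>x\<in>X. \<exists>z. (y, x, z) \<in> P) \<and>
     (\<forall>y\<in>X. (\<forall>x\<in>X. \<exists>z. (y, x, z) \<in> P) \<or>
        (\<forall>w\<in>V. (\<exists>z. (y, w, z) \<in> P) \<and> (w, f w y) \<in> orbit_rel X f W) \<and>
        (\<forall>x\<in>X. (\<exists>z. (y, x, z) \<in> P) \<or> (x, f x y) \<in> orbit_rel X f V)) \<and>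
     A = {(y, f r y) |y r. y \<in> X \<and> r \<in> orbit_rep (orbit_rel X f V) ` X \<and>
                           (r, f r y) \<in> orbit_rel X f V})"

text \<open>Distributivity says that \<open>f\<^sub>w\<close> conjugates \<open>f\<^sub>v\<close>
  into the permutation of \<open>v \<triangleright> w\<close>. Once \<open>f\<^sub>w\<close> is
  known, each of these two determines the other, so agreement spreads from \<open>u\<close> along
  the orbit.\<close>

lemma colours_agree_on_orbit:
  assumes f: "rack X f" and g: "rack X g" and W: "W \<subseteq> X"
    and agree: "\<And>x w. x \<in> X \<Longrightarrow> w \<in> W \<Longrightarrow> f x w = g x w"
    and uv: "(u, v) \<in> orbit_rel X f W" "u \<in> W" and x: "x \<in> X"
  shows "f x v = g x v"
proof -
  interpret f: rack X f by fact
  interpret g: rack X g by fact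
  have "v \<in> X \<and> (\<forall>x\<in>X. f x v = g x v)"
  proof (rule orbit_rel_induct[OF uv(1)])
    show "u \<in> X" using uv W by auto
    show "f x w \<in> X" if "x \<in> X" "w \<in> W" for x w
      using that W f.closed by blast
    show "\<forall>x\<in>X. f x u = g x u" using agree uv by blast
  next
    fix v w assume v: "v \<in> X" and w: "w \<in> W" and IH: "\<forall>x\<in>X. f x v = g x v"
    have wX: "w \<in> X" using w W by auto
    show "\<forall>x\<in>X. f x (f v w) = g x (f v w)"
    proof
      fix x' assume "x' \<in> X"
      then obtain x where x: "x \<in> X" "x' = f x w"
        using f.bij[OF wX] by (auto simp: bij_betw_def)
      have "f (f x w) (f v w) = f (f x v) w"
        using f.distrib[OF x(1) v wX] by simp
      also have "\<dots> = g (g x v) w"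
        using IH x(1) agree[OF f.closed[OF x(1) v] w] by simp
      also have "\<dots> = g (g x w) (g v w)"
        using g.distrib[OF x(1) v wX] by simp
      also have "\<dots> = g (f x w) (f v w)"
        using agree x v w by simp
      finally show "f x' (f v w) = g x' (f v w)" using x by simp
    qed
  next
    fix v w assume v: "v \<in> X" and w: "w \<in> W" and IH: "\<forall>x\<in>X. f x (f v w) = g x (f v w)"
    have wX: "w \<in> X" using w W by auto
    show "\<forall>x\<in>X. f x v = g x v"
    proof
      fix x assume x: "x \<in> X"
      have "f (f x v) w = f (f x w) (f v w)"
        using f.distrib[OF x v wX] by simp
      also have "\<dots> = g (g x w) (g v w)"
        using IH f.closed[OF x wX] agree x v w by simp
      also have "\<dots> = g (g x v) w"
        using g.distrib[OF x v wX] by simp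
      also have "\<dots> = f (g x v) w"
        using agree[OF g.closed[OF x v] w] by simp
      finally show "f x v = g x v"
        using f.cancel f.closed g.closed x v wX by blast
    qed
  qed
  then show ?thesis using x by blast
qed

text \<open>Decoding goes in stages: \<open>P\<close> gives the colours in \<open>W\<close>, hence
  the \<open>V\<close>-orbits and all colours in \<open>W\<close>-orbits of points of
  \<open>W\<close>. For other \<open>y\<close>, the law \<open>(x \<triangleright> w)
  \<triangleright> y = (x \<triangleright> y) \<triangleright> (w \<triangleright> y)\<close>
  carries the value at a representative through its \<open>V\<close>-orbit.\<close>

lemma encodes_unique:
  assumes f: "rack X f" and g: "rack X g"
    and ef: "encodes X f c" and eg: "encodes X g c"
    and x: "x \<in> X" and y: "y \<in> X"
  shows "f x y = g x y"
proof -
  interpret f: rack X f by fact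
  interpret g: rack X g by fact
  obtain V W P A where c: "c = (V, W, P, A)" by (cases c) auto
  note ef = ef[unfolded c encodes_def, simplified] and eg = eg[unfolded c encodes_def, simplified]
  have VW: "V \<subseteq> W" and WX: "W \<subseteq> X" using ef by blast+
  have stored: "f x y = g x y" if "(y, x, z) \<in> P" for y x z
    using ef eg that by metis
  have agree: "f x w = g x w" if "x \<in> X" "w \<in> W" for x w
  proof -
    have "\<exists>z. (w, x, z) \<in> P" using ef that by blast
    then show ?thesis using stored by blast
  qed
  define R where "R = orbit_rel X f V"
  have Rg: "orbit_rel X g V = R"
    unfolding R_def using agree VW by (intro orbit_rel_cong) force
  show ?thesis
  proof (cases "\<forall>x\<in>X. \<exists>z. (y, x, z) \<in> P")
    case True
    then show ?thesis using stored x by blast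
  next
    case False
    have fV: "(\<exists>z. (y, w, z) \<in> P) \<and> (w, f w y) \<in> orbit_rel X f W" if "w \<in> V" for w
      using ef y False that by blast
    have fX: "(\<exists>z. (y, x, z) \<in> P) \<or> (x, f x y) \<in> R" if "x \<in> X" for x
      using ef y False that unfolding R_def by blast
    have gX: "(\<exists>z. (y, x, z) \<in> P) \<or> (x, g x y) \<in> R" if "x \<in> X" for x
      using eg y False that unfolding Rg by blast
    \<comment> \<open>The point \<open>f w y\<close> is stored and lies in the
      \<open>W\<close>-orbit of \<open>w\<close>, so its permutation is already known.\<close>
    have conj_agree: "f x (f w y) = g x (g w y)" if "w \<in> V" "x \<in> X" for w x
    proof -
      have "f w y = g w y" using fV[OF that(1)] stored by blast
      then show ?thesis
        using colours_agree_on_orbit[OF f g WX agree, of w "f w y" x] fV[OF that(1)] that VW by auto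
    qed
    define r where "r = orbit_rep R x"
    have xr: "(x, r) \<in> R"
      unfolding r_def R_def by (rule orbit_rep_related)
    have rX: "r \<in> X"
      using f.orbit_subset[of V x] xr VW WX x by (auto simp: R_def)
    have ry: "f r y = g r y"
    proof (cases "\<exists>z. (y, r, z) \<in> P")
      case True
      then show ?thesis using stored by blast
    next
      case False
      then have rf: "(r, f r y) \<in> R" and rg: "(r, g r y) \<in> R"
        using fX gX rX by blast+
      have "r \<in> orbit_rep R ` X" using x by (simp add: r_def)
      then have fA: "(y, f r y) \<in> A"
        using ef rf y unfolding R_def by blast
      have gA: "A = {(y, g r y) |y r. y \<in> X \<and> r \<in> orbit_rep R ` X \<and> (r, g r y) \<in> R}"
        using eg unfolding Rg by blast
      \<comment> \<open>Read through \<open>g\<close>, the pair in \<open>A\<close> comes from some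
        representative \<open>s\<close>. Both \<open>r\<close> and \<open>s\<close> lie in the orbit
        of \<open>f r y\<close>, so they coincide.\<close>
      have "\<exists>s. s \<in> orbit_rep R ` X \<and> (s, g s y) \<in> R \<and> g s y = f r y"
        using fA unfolding gA mem_Collect_eq prod.inject by metis
      then obtain s where s: "s \<in> orbit_rep R ` X" "(s, g s y) \<in> R" "g s y = f r y"
        by blast
      have "(r, s) \<in> R"
        using rf s(2,3) unfolding R_def by (metis orbit_rel_sym orbit_rel_trans)
      moreover have "orbit_rep R t = t" if "t \<in> orbit_rep R ` X" for t
        using that orbit_rep_eq[OF orbit_rep_related, of X f V] by (auto simp: R_def)
      ultimately have "r = s"
        using s(1) \<open>r \<in> orbit_rep R ` X\<close> orbit_rep_eq unfolding R_def by metis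
      then show ?thesis using s by simp
    qed
    have "(r, x) \<in> orbit_rel X f V"
      using xr orbit_rel_sym unfolding R_def by metis
    then have "x \<in> X \<and> f x y = g x y"
    proof (rule orbit_rel_induct)
      show "f x w \<in> X" if "x \<in> X" "w \<in> V" for x w
        using that VW WX f.closed by blast
    next
      fix x w assume x: "x \<in> X" and w: "w \<in> V"
      then have wX: "w \<in> X" and fg: "f x w = g x w"
        using VW WX agree by blast+
      have yw: "f w y = g w y" using fV[OF w] stored by blast
      have df: "f (f x w) y = f (f x y) (f w y)"
        and dg: "g (f x w) y = g (g x y) (g w y)"
        using f.distrib[OF x wX y] g.distrib[OF x wX y] fg by simp_all
      show "f (f x w) y = g (f x w) y" if "f x y = g x y"
        using df dg conj_agree[OF w f.closed[OF x y]] that by simp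
      show "f x y = g x y" if "f (f x w) y = g (f x w) y"
      proof -
        have "f (f x y) (f w y) = f (g x y) (f w y)"
          using that df dg conj_agree[OF w g.closed[OF x y]] by simp
        then show ?thesis
          using f.cancel f.closed g.closed x wX y by blast
      qed
    qed (use rX ry in auto)
    then show ?thesis by blast
  qed
qed

text \<open>Colours in \<open>K\<close> are stored in full, the others only at \<open>V\<close> and
  at the points they move off their \<open>V\<close>-orbit. With \<open>L = log 2 n\<close> this
  makes \<open>O(n\<^sup>2 / L)\<close> triples, each of \<open>O(L)\<close> bits.\<close>

lemma (in finite_rack) exists_code:
  fixes L :: real
  assumes "L > 0" "log 2 (card X) \<le> L"
  obtains V W P A where "encodes X (\<triangleright>) (V, W, P, A)" "V \<subseteq> X" "W \<subseteq> X" "P \<subseteq> X \<times> X \<times> X" "A \<subseteq> X \<times> X"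
    "card P \<le> card X * (L ^ 5 + 2 * L ^ 2 + 6 * card X / L)"
proof -
  obtain V W K where sub: "V \<subseteq> W" "W \<subseteq> K" "K \<subseteq> X" and cV: "card V \<le> L ^ 2"
    and cK: "card K \<le> L ^ 5 + L ^ 2 + 4 * card X / L"
    and m: "\<And>y. y \<in> X - K \<Longrightarrow> card (moved X (\<triangleright>) V y) \<le> 2 * card X / L"
    and o: "\<And>y w. y \<in> X - K \<Longrightarrow> w \<in> V \<Longrightarrow> (w, w \<triangleright> y) \<in> orbit_rel X (\<triangleright>) W"
    using exists_skeleton[OF assms] by metis
  have VX: "V \<subseteq> X" and WX: "W \<subseteq> X" using sub by auto
  define B where "B y = (if y \<in> K then X else V \<union> moved X (\<triangleright>) V y)" for y
  define P where "P = (\<lambda>(y, x). (y, x, x \<triangleright> y)) ` (SIGMA y:X. B y)"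
  define A where "A = {(y, r \<triangleright> y) |y r. y \<in> X \<and> r \<in> orbit_rep (orbit_rel X (\<triangleright>) V) ` X \<and>
                           (r, r \<triangleright> y) \<in> orbit_rel X (\<triangleright>) V}"
  have B: "B y \<subseteq> X" for y using VX by (auto simp: B_def moved_def)
  have P: "(\<exists>z. (y, x, z) \<in> P) \<longleftrightarrow> y \<in> X \<and> x \<in> B y" for y x
    by (auto simp: P_def)
  show thesis
  proof
    show "V \<subseteq> X" "W \<subseteq> X" by fact+
    show "P \<subseteq> X \<times> X \<times> X"
      using B closed by (auto simp: P_def)
    have "orbit_rep (orbit_rel X (\<triangleright>) V) x \<in> X" if "x \<in> X" for x
      using orbit_subset[OF VX that] orbit_rep_related[of x X "(\<triangleright>)" V] by auto
    then show "A \<subseteq> X \<times> X"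
      using closed by (auto simp: A_def)
    have "\<forall>x\<in>X. x \<in> B y \<or> (x, x \<triangleright> y) \<in> orbit_rel X (\<triangleright>) V" if "y \<notin> K" for y
      using that by (auto simp: B_def moved_def)
    moreover have "\<forall>y\<in>W. \<forall>x\<in>X. y \<in> X \<and> x \<in> B y"
      using sub by (auto simp: B_def)
    moreover have "\<forall>w\<in>V. w \<in> B y" for y
      using VX by (auto simp: B_def)
    moreover have "\<forall>x\<in>X. x \<in> B y" if "y \<in> K" for y
      using that by (auto simp: B_def)
    moreover have "\<forall>y x z. (y, x, z) \<in> P \<longrightarrow> x \<triangleright> y = z"
      by (auto simp: P_def)
    ultimately show "encodes X (\<triangleright>) (V, W, P, A)"
      unfolding encodes_def prod.case P
      using o WX sub(1) A_def by (intro conjI) blast+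
    have bB: "real (card (B y)) \<le> (if y \<in> K then real (card X) else 0) + (L ^ 2 + 2 * card X / L)"
      if "y \<in> X" for y
    proof (cases "y \<in> K")
      case True
      then show ?thesis using assms(1) by (simp add: B_def)
    next
      case False
      have "card (B y) \<le> card V + card (moved X (\<triangleright>) V y)"
        using False by (simp add: B_def card_Un_le)
      also have "real \<dots> \<le> L ^ 2 + 2 * card X / L"
        using m[of y] False that cV by simp
      finally show ?thesis using False by simp
    qed
    have "card P \<le> card (SIGMA y:X. B y)"
      unfolding P_def using B finite_subset[OF B] by (intro card_image_le) auto
    also have "\<dots> = (\<Sum>y\<in>X. card (B y))"
      using finite_subset[OF B] by simp
    also have "real \<dots> \<le> (\<Sum>y\<in>X. (if y \<in> K then real (card X) else 0) + (L ^ 2 + 2 * card X / L))"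
      unfolding of_nat_sum by (rule sum_mono) (rule bB)
    also have "\<dots> = card K * card X + card X * (L ^ 2 + 2 * card X / L)"
      using sub(3) by (simp add: sum.distrib sum.If_cases Int_absorb1 Int_def[symmetric])
    also have "\<dots> \<le> (L ^ 5 + L ^ 2 + 4 * card X / L) * card X + card X * (L ^ 2 + 2 * card X / L)"
      using cK by (intro add_right_mono) (simp add: mult_right_mono)
    also have "\<dots> = card X * (L ^ 5 + 2 * L ^ 2 + 6 * card X / L)"
      by (simp add: algebra_simps add_divide_distrib)
    finally show "card P \<le> card X * (L ^ 5 + 2 * L ^ 2 + 6 * card X / L)"
      by simp
  qed
qed

section \<open>Counting isomorphism classes\<close>

text \<open>Both relations restrict the same \<open>isomorphic\<close>, so a class of
  \<open>S\<close> is the trace on \<open>S\<close> of a class of \<open>T\<close>.\<close>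

lemma iso_classes_subset:
  assumes "S \<subseteq> T"
  shows "iso_classes S \<subseteq> (\<lambda>C. C \<inter> S) ` iso_classes T"
proof
  fix C assume "C \<in> iso_classes S"
  then obtain x where x: "x \<in> S" "C = Restr isomorphic S `` {x}"
    by (auto simp: iso_classes_def elim: quotientE)
  then have "C = (Restr isomorphic T `` {x}) \<inter> S" "Restr isomorphic T `` {x} \<in> iso_classes T"
    using assms by (auto simp: iso_classes_def quotient_def)
  then show "C \<in> (\<lambda>C. C \<inter> S) ` iso_classes T" by blast
qed

lemma card_iso_classes_mono:
  assumes "S \<subseteq> T" "finite (iso_classes T)"
  shows "finite (iso_classes S)" "card (iso_classes S) \<le> card (iso_classes T)"
  using iso_classes_subset[OF assms(1)] assms(2) by (auto intro: finite_surj surj_card_le)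

lemma exists_isomorphic_on_lessThan:
  assumes "(X, f) \<in> of_order rack n"
  obtains g where "({..<n}, g) \<in> of_order rack n" "((X, f), ({..<n}, g)) \<in> isomorphic"
proof -
  have f: "rack X f" and X: "finite X" "card X = n"
    using assms by (auto simp: of_order_def)
  interpret f: rack X f by fact
  obtain \<theta> where \<theta>: "bij_betw \<theta> X {..<n}"
    using finite_same_card_bij[OF X(1), of "{..<n}"] X(2) by auto
  define \<eta> where "\<eta> = inv_into X \<theta>"
  have \<eta>: "bij_betw \<eta> {..<n} X"
    unfolding \<eta>_def by (rule bij_betw_inv_into[OF \<theta>])
  have \<eta>X: "\<eta> a \<in> X" if "a < n" for a
    using bij_betw_apply[OF \<eta>] that by simp
  have \<eta>\<theta>: "\<eta> (\<theta> x) = x" if "x \<in> X" for x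
    using \<theta> that by (simp add: \<eta>_def bij_betw_inv_into_left)
  define g where "g a b = \<theta> (f (\<eta> a) (\<eta> b))" for a b
  have "rack {..<n} g"
  proof
    fix y assume "y \<in> {..<n}"
    then have "bij_betw (\<theta> \<circ> ((\<lambda>x. f x (\<eta> y)) \<circ> \<eta>)) {..<n} {..<n}"
      by (intro bij_betw_trans[OF _ \<theta>] bij_betw_trans[OF \<eta>] f.bij \<eta>X) simp
    then show "bij_betw (\<lambda>x. g x y) {..<n} {..<n}"
      by (simp add: g_def comp_def)
  next
    fix x y z assume "x \<in> {..<n}" "y \<in> {..<n}" "z \<in> {..<n}"
    then show "g (g x y) z = g (g x z) (g y z)"
      using \<eta>X f.closed f.distrib[of "\<eta> x" "\<eta> y" "\<eta> z"] by (simp add: g_def \<eta>\<theta>)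
  qed
  moreover have "rack_iso \<theta> X f {..<n} g"
    using \<theta> by (simp add: rack_iso_def g_def \<eta>\<theta>)
  ultimately show thesis
    using that by (auto simp: of_order_def isomorphic_def)
qed

text \<open>Choose a rack on \<open>{..<n}\<close> in each class and a code for it. Equal codes
  force equal operations on \<open>{..<n}\<close>, so the identity is an isomorphism and the classes
  coincide. Finiteness is recorded because \<open>card\<close> is 0 on infinite sets.\<close>

lemma card_iso_classes_rack_le:
  assumes "finite C"
    and ex: "\<And>f. rack {..<n} f \<Longrightarrow> \<exists>c\<in>C. encodes {..<n} f c"
  shows "finite (iso_classes (of_order rack n))" "f_rack n \<le> card C"
proof -
  define S where "S = of_order rack n"
  define R where "R = Restr isomorphic S"
  have R: "equiv S R"
    unfolding R_def by (rule equiv_isomorphic[of _ n]) (simp add: S_def)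
  have "\<exists>g c. ({..<n}, g) \<in> D \<and> rack {..<n} g \<and> c \<in> C \<and> encodes {..<n} g c" if D: "D \<in> S // R" for D
  proof -
    obtain X f where Xf: "(X, f) \<in> S" "D = R `` {(X, f)}"
      using quotientE[OF D] by (metis surj_pair)
    obtain g where g: "({..<n}, g) \<in> S" "((X, f), ({..<n}, g)) \<in> isomorphic"
      using exists_isomorphic_on_lessThan[of X f n] Xf(1) unfolding S_def by metis
    have "rack {..<n} g" using g(1) by (simp add: S_def of_order_def)
    moreover have "({..<n}, g) \<in> D"
      using Xf g by (simp add: R_def)
    ultimately show ?thesis
      using ex by blast
  qed
  then obtain g c where gc: "\<And>D. D \<in> S // R \<Longrightarrow>
      ({..<n}, g D) \<in> D \<and> rack {..<n} (g D) \<and> c D \<in> C \<and> encodes {..<n} (g D) (c D)"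
    by metis
  have inj: "inj_on c (S // R)"
  proof
    fix D E assume D: "D \<in> S // R" and E: "E \<in> S // R" and "c D = c E"
    then have "g D x y = g E x y" if "x < n" "y < n" for x y
      using encodes_unique[of "{..<n}" "g D" "g E" "c D" x y] gc[OF D] gc[OF E] that by simp
    then have "rack_iso id {..<n} (g D) {..<n} (g E)"
      by (simp add: rack_iso_def)
    moreover have "({..<n}, g D) \<in> S" "({..<n}, g E) \<in> S"
      using gc[OF D] gc[OF E] by (simp_all add: S_def of_order_def)
    ultimately have "(({..<n}, g D), ({..<n}, g E)) \<in> R"
      by (auto simp: R_def isomorphic_def)
    then show "D = E"
      using quotient_eq_iff[OF R D E] gc[OF D] gc[OF E] by blast
  qed
  moreover have "c ` (S // R) \<subseteq> C" using gc by blast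
  ultimately have "finite (S // R)" "card (S // R) \<le> card C"
    using inj_on_finite[of c "S // R" C] card_inj_on_le[of c "S // R" C] \<open>finite C\<close> by auto
  then show "finite (iso_classes (of_order rack n))" "f_rack n \<le> card C"
    by (simp_all add: f_rack_def iso_classes_def S_def R_def)
qed

text \<open>A set of size at most \<open>m + 1\<close> arises from one of size at most
  \<open>m\<close> by inserting one point or, for \<open>None\<close>, nothing.\<close>

lemma card_bounded_subsets:
  assumes "finite A"
  shows "card {S. S \<subseteq> A \<and> card S \<le> m} \<le> (card A + 1) ^ m"
proof (induction m)
  case 0
  have "{S. S \<subseteq> A \<and> card S \<le> 0} = {{}}"
    using assms finite_subset by fastforce
  then show ?case by simp
next
  case (Suc m)
  let ?F = "\<lambda>m. {S. S \<subseteq> A \<and> card S \<le> m}"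
  let ?h = "\<lambda>(a, S). case a of None \<Rightarrow> S | Some x \<Rightarrow> insert x S"
  have fin: "finite (?F m)" using assms by simp
  have "?F (Suc m) \<subseteq> ?h ` ((insert None (Some ` A)) \<times> ?F m)"
  proof
    fix S assume S: "S \<in> ?F (Suc m)"
    have finS: "finite S" using S assms finite_subset by auto
    show "S \<in> ?h ` ((insert None (Some ` A)) \<times> ?F m)"
    proof (cases "card S \<le> m")
      case True
      then show ?thesis using S by (intro image_eqI[of _ _ "(None, S)"]) auto
    next
      case False
      then obtain x where x: "x \<in> S" using S by fastforce
      then show ?thesis
        using S finS by (intro image_eqI[of _ _ "(Some x, S - {x})"]) auto
    qed
  qed
  then have "card (?F (Suc m)) \<le> card ((insert None (Some ` A)) \<times> ?F m)"
    using assms fin by (intro surj_card_le) auto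
  also have "\<dots> = (card A + 1) * card (?F m)"
    using assms by (simp add: card_cartesian_product card_insert_disjoint card_image image_iff)
  also have "\<dots> \<le> (card A + 1) ^ Suc m"
    using Suc.IH by (simp del: mult_Suc)
  finally show ?case .
qed

text \<open>A triple in \<open>P\<close> costs at most \<open>4 * L\<close> bits, in total at most
  \<open>25 * n\<^sup>2\<close> once the polylogarithmic terms are absorbed into one
  \<open>n\<^sup>2\<close>. \<open>A\<close> adds \<open>n\<^sup>2\<close> and the two colour sets
  \<open>2 * n\<close>, whence 28.\<close>

lemma f_rack_upper_bound:
  "\<forall>\<^sub>F n in sequentially. finite (iso_classes (of_order rack n)) \<and>
     real (f_rack n) \<le> 2 powr (28 * (real n)\<^sup>2)"
proof -
  have "\<forall>\<^sub>F n::nat in sequentially. 4 * ((log 2 n) ^ 6 + 2 * (log 2 n) ^ 3) \<le> n"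
    by real_asymp
  then show ?thesis
    using eventually_ge_at_top[of 2]
  proof eventually_elim
    case (elim n)
    define L where "L = log 2 (real n)"
    have L: "L > 0" using elim(2) by (simp add: L_def)
    define b where "b = n * (L ^ 5 + 2 * L ^ 2 + 6 * n / L)"
    define m where "m = nat \<lfloor>b\<rfloor>"
    have b: "b \<ge> 0" using L by (simp add: b_def)
    let ?X = "{..<n}"
    let ?P = "{P. P \<subseteq> ?X \<times> ?X \<times> ?X \<and> card P \<le> m}"
    define C where "C = Pow ?X \<times> Pow ?X \<times> ?P \<times> Pow (?X \<times> ?X)"
    have fin: "finite C"
      unfolding C_def by (auto intro!: finite_cartesian_product)
    have "\<exists>c\<in>C. encodes ?X f c" if f: "rack ?X f" for f
    proof -
      interpret rack ?X f by fact
      interpret finite_rack ?X f by unfold_locales simp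
      obtain V W P A where "encodes ?X f (V, W, P, A)" "V \<subseteq> ?X" "W \<subseteq> ?X"
        "P \<subseteq> ?X \<times> ?X \<times> ?X" "A \<subseteq> ?X \<times> ?X" "card P \<le> b"
        using exists_code[OF L, unfolded card_lessThan, folded b_def] L_def by blast
      moreover from this(6) have "card P \<le> m"
        by (simp add: m_def le_nat_floor)
      ultimately show ?thesis
        by (intro bexI[of _ "(V, W, P, A)"]) (simp_all add: C_def)
    qed
    note le = card_iso_classes_rack_le[OF fin this]
    have step: "(real n ^ 3 + 1) ^ m \<le> 2 powr (25 * (real n)\<^sup>2)"
    proof -
      have "n ^ 3 + 1 \<le> n ^ 4"
      proof -
        have "n ^ 3 + 1 \<le> n ^ 3 * 2" using elim(2) by simp
        also have "\<dots> \<le> n ^ 3 * n" using elim(2) by (intro mult_le_mono) auto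
        finally show ?thesis by (simp add: power_numeral_reduce algebra_simps)
      qed
      then have "real (n ^ 3 + 1) \<le> real (n ^ 4)"
        by (rule of_nat_mono)
      then have "(real n ^ 3 + 1) ^ m \<le> (real n ^ 4) ^ m"
        by (intro power_mono) simp_all
      also have "\<dots> = (2 powr L) powr (4 * m)"
        using elim(2) powr_realpow[of "real n" "4 * m"] by (simp add: L_def flip: power_mult)
      also have "\<dots> = 2 powr (4 * L * m)"
        by (simp add: powr_powr mult.commute mult.left_commute)
      also have "\<dots> \<le> 2 powr (25 * (real n)\<^sup>2)"
      proof (rule powr_mono)
        have "4 * L * m \<le> 4 * L * b"
          using L b by (simp add: m_def)
        also have "\<dots> = n * (4 * (L ^ 6 + 2 * L ^ 3)) + 24 * (real n)\<^sup>2"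
          using L by (simp add: b_def field_simps power_numeral_reduce)
        also have "\<dots> \<le> real n * real n + 24 * (real n)\<^sup>2"
          using elim(1) by (intro add_right_mono mult_left_mono) (simp_all add: L_def)
        finally show "4 * L * m \<le> 25 * (real n)\<^sup>2"
          by (simp add: power2_eq_square)
      qed simp
      finally show ?thesis .
    qed
    have "card C = 2 ^ n * (2 ^ n * (card ?P * 2 ^ (n * n)))"
      by (simp add: C_def card_cartesian_product card_Pow)
    also have "\<dots> \<le> 2 ^ n * (2 ^ n * ((n ^ 3 + 1) ^ m * 2 ^ (n * n)))"
      using card_bounded_subsets[of "?X \<times> ?X \<times> ?X" m]
      by (intro mult_le_mono) (simp_all add: card_cartesian_product power3_eq_cube mult.assoc)
    finally have "real (card C) \<le> real (2 ^ n * (2 ^ n * ((n ^ 3 + 1) ^ m * 2 ^ (n * n))))"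
      by (rule of_nat_mono)
    also have "\<dots> = 2 powr real n * (2 powr real n * ((real n ^ 3 + 1) ^ m * 2 powr (real n * real n)))"
      using powr_realpow[of 2 "n * n"] by (simp add: powr_realpow add.commute)
    also have "\<dots> \<le> 2 powr real n * (2 powr real n * (2 powr (25 * (real n)\<^sup>2) * 2 powr (real n * real n)))"
      by (intro mult_left_mono mult_right_mono step) simp_all
    also have "\<dots> = 2 powr (2 * real n + 26 * (real n)\<^sup>2)"
      by (simp add: power2_eq_square flip: powr_add)
    also have "\<dots> \<le> 2 powr (28 * (real n)\<^sup>2)"
      using elim(2) by (intro powr_mono) (simp_all add: power2_eq_square)
    finally show ?case
      using le by (auto intro: order_trans[OF of_nat_mono])
  qed
qed

section \<open>Many kei\<close>

definition swap_pair :: "nat \<Rightarrow> nat" where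
  "swap_pair x = (if even x then x + 1 else x - 1)"

definition kei_op :: "nat \<Rightarrow> (nat \<times> nat) set \<Rightarrow> nat \<Rightarrow> nat \<Rightarrow> nat" where
  "kei_op m T x y = (if x < 2 * m \<and> (x div 2, y) \<in> T then swap_pair x else x)"

lemma swap_pair_simps [simp]:
  "swap_pair x div 2 = x div 2" "swap_pair (swap_pair x) = x" "swap_pair x \<noteq> x"
  "swap_pair x < 2 * m \<longleftrightarrow> x < 2 * m"
  unfolding swap_pair_def by (auto elim!: evenE oddE)

text \<open>The permutations are products of swaps of the same pairs and hence commute. Moreover
  \<open>y\<close> and its image under \<open>z\<close> act alike: points of pairs act trivially and
  stay in their pair, all others are fixed. So distributivity is commutation.\<close>

lemma kei_op_kei:
  assumes m: "2 * m \<le> n" and T: "T \<subseteq> {..<m} \<times> {2 * m..<n}"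
  shows "kei {..<n} (kei_op m T)"
proof
  have closed: "kei_op m T x y < n" if "x < n" for x y
  proof -
    have "swap_pair x < n" if "x < 2 * m"
      using swap_pair_simps(4)[of x m] that m by linarith
    then show ?thesis using that by (simp add: kei_op_def)
  qed
  have inv: "kei_op m T (kei_op m T x y) y = x" for x y
    by (simp add: kei_op_def)
  show "bij_betw (\<lambda>x. kei_op m T x y) {..<n} {..<n}" for y
    by (rule bij_betw_byWitness[of _ "\<lambda>x. kei_op m T x y"]) (auto simp: inv closed)
  show "kei_op m T (kei_op m T x y) y = x" for x y
    by (rule inv)
  have T': "(i, y) \<notin> T" if "y < 2 * m" for i y
    using that T by auto
  show "kei_op m T x x = x" for x
    using T' by (simp add: kei_op_def)
  show "kei_op m T (kei_op m T x y) z = kei_op m T (kei_op m T x z) (kei_op m T y z)" for x y z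
  proof (cases "y < 2 * m")
    case True
    moreover from this have "kei_op m T y z < 2 * m" by (simp add: kei_op_def)
    ultimately have "kei_op m T u y = u" "kei_op m T u (kei_op m T y z) = u" for u
      using T' by (simp_all add: kei_op_def)
    then show ?thesis by simp
  next
    case False
    then show ?thesis by (simp add: kei_op_def)
  qed
qed

text \<open>Both \<open>g\<close> and \<open>h\<close> are \<open>f\<close> transported along maps
  that agree on \<open>X\<close>; hence a class has no more operations on \<open>X\<close> than
  there are maps.\<close>

lemma rack_iso_determines_op:
  assumes "rack X f" "rack_iso \<theta> X f X g" "rack_iso \<eta> X f X h"
    and "\<And>x. x \<in> X \<Longrightarrow> \<theta> x = \<eta> x" and "a \<in> X" "b \<in> X"
  shows "g a b = h a b"
proof -
  obtain x y where xy: "x \<in> X" "y \<in> X" "a = \<theta> x" "b = \<theta> y"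
    using assms(2,5,6) unfolding rack_iso_def bij_betw_def by (metis imageE)
  moreover have "f x y \<in> X" using rack.closed[OF assms(1)] xy by simp
  ultimately show ?thesis
    using assms(2,3,4) by (metis rack_iso_def)
qed

lemma kei_op_inj:
  assumes "T \<subseteq> {..<m} \<times> {2 * m..<n}" "T' \<subseteq> {..<m} \<times> {2 * m..<n}" "2 * m \<le> n"
    and eq: "\<And>a b. a < n \<Longrightarrow> b < n \<Longrightarrow> kei_op m T a b = kei_op m T' a b"
  shows "T = T'"
proof -
  have "(i, y) \<in> T \<longleftrightarrow> (i, y) \<in> T'" if "i < m" "y < n" for i y
    using eq[of "2 * i" y] that assms(3) swap_pair_simps(3)[of "2 * i"]
    by (auto simp: kei_op_def simp del: swap_pair_simps split: if_splits)
  then have "p \<in> T \<longleftrightarrow> p \<in> T'" for p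
    using assms(1,2) by (cases p; cases "fst p < m \<and> snd p < n") auto
  then show ?thesis by blast
qed

text \<open>Given its class, \<open>T\<close> is determined by an isomorphism from a fixed kei of
  that class, and at most \<open>n ^ n\<close> maps are available.\<close>

lemma f_kei_ge:
  assumes fin: "finite (iso_classes (of_order kei n))" and m: "2 * m \<le> n"
  shows "2 ^ (m * (n - 2 * m)) \<le> f_kei n * n ^ n"
proof -
  let ?X = "{..<n}"
  define S where "S = of_order kei n"
  define \<T> where "\<T> = Pow ({..<m} \<times> {2 * m..<n})"
  define cl where "cl T = Restr isomorphic S `` {(?X, kei_op m T)}" for T
  have kei_rack: "rack X f" if "kei X f" for X :: "nat set" and f
    using that by (simp add: kei_def quandle_def)
  have S: "(?X, kei_op m T) \<in> S" if "T \<in> \<T>" for T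
    using kei_op_kei[OF m] that by (simp add: S_def of_order_def \<T>_def)
  have equiv: "equiv S (Restr isomorphic S)"
    by (rule equiv_isomorphic[of _ n]) (auto simp: S_def of_order_def kei_rack)
  \<comment> \<open>The choice is made from the class and not from \<open>T\<close>, so all sets in
    one class get the same base kei.\<close>
  define base where "base D = (SOME T. T \<in> \<T> \<and> cl T = D)" for D
  have base: "base (cl T) \<in> \<T> \<and> cl (base (cl T)) = cl T" if "T \<in> \<T>" for T
    unfolding base_def by (rule someI[of _ T]) (use that in simp)
  have "\<exists>\<theta>. rack_iso \<theta> ?X (kei_op m (base (cl T))) ?X (kei_op m T)" if T: "T \<in> \<T>" for T
  proof -
    have "((?X, kei_op m (base (cl T))), (?X, kei_op m T)) \<in> Restr isomorphic S"
      using eq_equiv_class[OF _ equiv, of "(?X, kei_op m (base (cl T)))" "(?X, kei_op m T)"]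
        base[OF T] S[OF T] unfolding cl_def by blast
    then show ?thesis by (simp add: isomorphic_def)
  qed
  then obtain \<theta> where \<theta>: "\<And>T. T \<in> \<T> \<Longrightarrow>
      rack_iso (\<theta> T) ?X (kei_op m (base (cl T))) ?X (kei_op m T)"
    by metis
  define code where "code T = (cl T, restrict (\<theta> T) ?X)" for T
  have "inj_on code \<T>"
  proof
    fix T T' assume T: "T \<in> \<T>" "T' \<in> \<T>" and "code T = code T'"
    then have cl: "cl T' = cl T" and "restrict (\<theta> T) ?X = restrict (\<theta> T') ?X"
      by (simp_all add: code_def)
    then have r: "\<theta> T x = \<theta> T' x" if "x \<in> ?X" for x
      using that by (metis restrict_apply')
    have "rack ?X (kei_op m (base (cl T)))"
      using S base[OF T(1)] kei_rack by (auto simp: S_def of_order_def)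
    then have "kei_op m T a b = kei_op m T' a b" if "a < n" "b < n" for a b
      using rack_iso_determines_op[OF _ \<theta>[OF T(1)], of "\<theta> T'" "kei_op m T'" a b] \<theta>[OF T(2)] cl r that
      by simp
    then show "T = T'"
      using kei_op_inj[of T m n T'] T m by (simp add: \<T>_def)
  qed
  moreover have "code ` \<T> \<subseteq> iso_classes S \<times> (?X \<rightarrow>\<^sub>E ?X)"
  proof
    fix p assume "p \<in> code ` \<T>"
    then obtain T where T: "T \<in> \<T>" "p = code T" by blast
    have "restrict (\<theta> T) ?X \<in> ?X \<rightarrow>\<^sub>E ?X"
      using \<theta>[OF T(1)] by (auto simp: rack_iso_def bij_betw_def)
    moreover have "cl T \<in> iso_classes S"
      using S[OF T(1)] by (auto simp: cl_def iso_classes_def intro: quotientI)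
    ultimately show "p \<in> iso_classes S \<times> (?X \<rightarrow>\<^sub>E ?X)"
      using T by (simp add: code_def)
  qed
  ultimately have "card \<T> \<le> card (iso_classes S \<times> (?X \<rightarrow>\<^sub>E ?X))"
    using fin by (intro card_inj_on_le) (auto simp: S_def intro!: finite_PiE)
  also have "\<dots> = f_kei n * n ^ n"
    by (simp add: card_cartesian_product card_PiE f_kei_def S_def)
  finally show ?thesis
    by (simp add: \<T>_def card_Pow card_cartesian_product)
qed

text \<open>Taking \<open>m\<close> near \<open>n / 4\<close> nearly maximises
  \<open>m * (n - 2 * m)\<close>, at about \<open>n\<^sup>2 / 8\<close>. Giving up half of this
  exponent pays for the factor \<open>n ^ n\<close>.\<close>

lemma f_kei_lower_bound:
  "\<forall>\<^sub>F n in sequentially. finite (iso_classes (of_order kei n)) \<longrightarrow>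
     2 powr (1 / 16 * (real n)\<^sup>2) \<le> real (f_kei n)"
proof -
  have "\<forall>\<^sub>F n::nat in sequentially. 1 / 16 * (real n)\<^sup>2 + n * log 2 n \<le> (real n / 4 - 1) * (real n / 2)"
    by real_asymp
  then show ?thesis
    using eventually_ge_at_top[of 4]
  proof eventually_elim
    case (elim n)
    define m where "m = n div 4"
    have m: "2 * m \<le> n" by (simp add: m_def)
    show ?case
    proof
      assume "finite (iso_classes (of_order kei n))"
      note le = f_kei_ge[OF this m]
      have "real n / 4 - 1 \<le> m" "real n / 2 \<le> real (n - 2 * m)"
        unfolding m_def by linarith+
      then have "(real n / 4 - 1) * (real n / 2) \<le> real m * real (n - 2 * m)"
        using elim(2) by (intro mult_mono) auto
      then have "2 powr (1 / 16 * (real n)\<^sup>2 + n * log 2 n) \<le> 2 powr real (m * (n - 2 * m))"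
        using elim(1) by (intro powr_mono) (auto simp del: of_nat_diff)
      also have "\<dots> = real (2 ^ (m * (n - 2 * m)))"
        by (subst powr_realpow) simp_all
      also have "\<dots> \<le> real (f_kei n) * real n ^ n"
        using le by (metis of_nat_le_iff of_nat_mult of_nat_power)
      also have "real n ^ n = 2 powr (n * log 2 n)"
        using elim(2) by (simp add: powr_realpow mult.commute[of "real n" "log _ _"] flip: powr_powr)
      finally show "2 powr (1 / 16 * (real n)\<^sup>2) \<le> real (f_kei n)"
        by (simp add: powr_add)
    qed
  qed
qed

theorem theorem1:
  shows "\<exists>c1 c2 :: real. c1 > 0 \<and> c2 > 0 \<and>
    (\<forall>\<^sub>F n in sequentially.
       2 powr (c1 * (real n)\<^sup>2) \<le> real (f_kei n) \<and>
       f_kei n \<le> f_quandle n \<and>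
       f_quandle n \<le> f_rack n \<and>
       real (f_rack n) \<le> 2 powr (c2 * (real n)\<^sup>2))"
proof (intro exI conjI)
  show "\<forall>\<^sub>F n in sequentially.
       2 powr (1 / 16 * (real n)\<^sup>2) \<le> real (f_kei n) \<and>
       f_kei n \<le> f_quandle n \<and>
       f_quandle n \<le> f_rack n \<and>
       real (f_rack n) \<le> 2 powr (28 * (real n)\<^sup>2)"
    using f_rack_upper_bound f_kei_lower_bound
  proof eventually_elim
    case (elim n)
    have sub: "of_order kei n \<subseteq> of_order quandle n" "of_order quandle n \<subseteq> of_order rack n"
      by (auto simp: of_order_def kei_def quandle_def)
    \<comment> \<open>Finiteness passes from racks down to kei, where it discharges the premise of
      the lower bound.\<close>
    note quandle = card_iso_classes_mono[OF sub(2)] and kei = card_iso_classes_mono[OF sub(1)]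
    show ?case
      using elim quandle kei by (simp add: f_kei_def f_quandle_def f_rack_def)
  qed
qed simp_all

end
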